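(* Let $m\ge 3$ and $n\ge 1$ be integers with $m\neq 2n$, and let $Y_{m,n}=C_m\,\square\,P_n$ be the stacked prism graph. Then its divisorial gonality is $\operatorname{gon}(Y_{m,n})=\min\{m,2n\}$.
   Context: $P_n$ is the path on $n$ vertices and $C_m$ is the cycle on $m$ vertices. The Cartesian product $G_1\,\square\,G_2$ has vertex set $V(G_1)\times V(G_2)$, with $(v_1,v_2)$ adjacent to $(u_1,u_2)$ iff either $v_2=u_2$ and $v_1u_1\in E(G_1)$, or $v_1=u_1$ and $v_2u_2\in E(G_2)$. Let $G$ be a finite connected simple graph. $\operatorname{Div}(G)$ is the free abelian group on $V(G)$; its elements $D=\sum_{v\in V(G)}a_v\cdot(v)$, $a_v\in\mathbb Z$, are called divisors. $D$ is effective if all $a_v\ge 0$, and $\deg(D)=\sum_v a_v$. The chip-firing move with respect to a vertex $w$ replaces $D$ by the divisor obtained by decreasing the coefficient of $w$ by $\operatorname{val}(w)$ (the number of edges incident to $w$) and increasing the coefficient of each neighbor of $w$ by $1$, leaving all other coefficients unchanged. Two divisors are equivalent if one can be obtained from the other by a sequence of chip-firing moves. The rank $r(D)$ is the largest integer $r\ge 0$ such that for every effective divisor $E$ with $\deg(E)=r$, the divisor $D-E$ is equivalent to an effective divisor; if no such $r$ exists, $r(D)=-1$. The (divisorial) gonality $\operatorname{gon}(G)$ is the smallest integer $k$ such that there is a divisor $D$ on $G$ with $\deg(D)=k$ and $r(D)\ge 1$. (Equivalently: the least degree of a divisor $D$ such that for every vertex $v$, $D-(v)$ is equivalent to an effective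 divisor.) *)

theory Defs
  imports
    "Graph_Theory.Pair_Digraph"
    "Graph_Theory.Digraph_Component"
    "HOL-Algebra.Free_Abelian_Groups"
begin

text \<open>A finite simple graph is a \<open>pair_graph\<close>: a finite, loop-free, symmetric digraph
  without parallel arcs. Every undirected edge contributes two arcs, one in each
  direction, so the valence of a vertex is its \<open>out_degree\<close>.\<close>

section \<open>Stacked prism graphs\<close>

definition path_graph :: "nat \<Rightarrow> nat pair_pre_digraph" where
  "path_graph n = \<lparr> pverts = {..<n},
     parcs = {(i, j). i < n \<and> j < n \<and> (j = Suc i \<or> i = Suc j)} \<rparr>"

text \<open>For \<open>m \<le> 2\<close> the following is not a cycle (\<open>m = 1\<close> gives a loop, \<open>m = 2\<close> a single edge).\<close>

definition cycle_graph :: "nat \<Rightarrow> nat pair_pre_digraph" where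
  "cycle_graph m = \<lparr> pverts = {..<m},
     parcs = {(i, j). i < m \<and> j < m \<and> (j = Suc i mod m \<or> i = Suc j mod m)} \<rparr>"

definition cartesian_product ::
  "'a pair_pre_digraph \<Rightarrow> 'b pair_pre_digraph \<Rightarrow> ('a \<times> 'b) pair_pre_digraph"
  (infixl \<open>\<box>\<close> 70) where
  "G \<box> H = \<lparr> pverts = pverts G \<times> pverts H,
     parcs = {((v\<^sub>1, v\<^sub>2), (u\<^sub>1, u\<^sub>2)).
       v\<^sub>1 \<in> pverts G \<and> v\<^sub>2 \<in> pverts H \<and> u\<^sub>1 \<in> pverts G \<and> u\<^sub>2 \<in> pverts H \<and>
       (v\<^sub>2 = u\<^sub>2 \<and> (v\<^sub>1, u\<^sub>1) \<in> parcs G \<or> v\<^sub>1 = u\<^sub>1 \<and> (v\<^sub>2, u\<^sub>2) \<in> parcs H)} \<rparr>"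

definition stacked_prism :: "nat \<Rightarrow> nat \<Rightarrow> (nat \<times> nat) pair_pre_digraph" where
  "stacked_prism m n = cycle_graph m \<box> path_graph n"


section \<open>Divisors, chip-firing, rank and gonality\<close>

text \<open>The definitions are meant for finite connected simple graphs. The divisor group is
  the library's free abelian group, whose elements are finitely supported functions
  \<open>'a \<Rightarrow>\<^sub>0 int\<close> with \<open>keys D \<subseteq> pverts G\<close>; \<open>frag_of v\<close> is the generator \<open>(v)\<close>.\<close>

definition Div :: "'a pair_pre_digraph \<Rightarrow> ('a \<Rightarrow>\<^sub>0 int) set" where
  "Div G = carrier (free_Abelian_group (pverts G))"

definition div_deg :: "'a pair_pre_digraph \<Rightarrow> ('a \<Rightarrow>\<^sub>0 int) \<Rightarrow> int" where
  "div_deg G D = (\<Sum>v\<in>pverts G. Poly_Mapping.lookup D v)"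

definition effective :: "'a pair_pre_digraph \<Rightarrow> ('a \<Rightarrow>\<^sub>0 int) \<Rightarrow> bool" where
  "effective G D \<longleftrightarrow> D \<in> Div G \<and> (\<forall>v\<in>pverts G. 0 \<le> Poly_Mapping.lookup D v)"

definition chip_fire :: "'a pair_pre_digraph \<Rightarrow> 'a \<Rightarrow> ('a \<Rightarrow>\<^sub>0 int) \<Rightarrow> ('a \<Rightarrow>\<^sub>0 int)" where
  "chip_fire G w D =
     D - frag_cmul (int (out_degree G w)) (frag_of w) + (\<Sum>u | (w, u) \<in> parcs G. frag_of u)"

text \<open>Reachability by a (possibly empty) sequence of moves. On a finite simple graph this
  is symmetric, see \<open>chip_equiv_sym\<close> below: firing every other vertex once undoes a move.\<close>

definition chip_equiv ::
  "'a pair_pre_digraph \<Rightarrow> ('a \<Rightarrow>\<^sub>0 int) \<Rightarrow> ('a \<Rightarrow>\<^sub>0 int) \<Rightarrow> bool" where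
  "chip_equiv G = (\<lambda>D D'. \<exists>w\<in>pverts G. D' = chip_fire G w D)\<^sup>*\<^sup>*"

definition rank_at_least :: "'a pair_pre_digraph \<Rightarrow> ('a \<Rightarrow>\<^sub>0 int) \<Rightarrow> nat \<Rightarrow> bool" where
  "rank_at_least G D r \<longleftrightarrow>
     (\<forall>E. effective G E \<and> div_deg G E = int r \<longrightarrow> (\<exists>D'. effective G D' \<and> chip_equiv G (D - E) D'))"

text \<open>The maximum exists as soon as the set is nonempty, see \<open>rank_at_least_le_deg\<close> below.\<close>

definition div_rank :: "'a pair_pre_digraph \<Rightarrow> ('a \<Rightarrow>\<^sub>0 int) \<Rightarrow> int" where
  "div_rank G D =
     (if \<exists>r. rank_at_least G D r then int (GREATEST r. rank_at_least G D r) else -1)"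

definition gonality :: "'a pair_pre_digraph \<Rightarrow> int" where
  "gonality G = (LEAST k. \<exists>D\<in>Div G. div_deg G D = k \<and> 1 \<le> div_rank G D)"


section \<open>Well-formedness facts\<close>

lemma pair_graph_path: "pair_graph (path_graph n)"
proof -
  have "finite (parcs (path_graph n))"
    by (rule finite_subset[of _ "{..<n} \<times> {..<n}"]) (auto simp: path_graph_def)
  then show ?thesis
    by unfold_locales (auto simp: path_graph_def symmetric_def intro: symI)
qed

lemma pair_graph_cycle:
  assumes "m \<ge> 3"
  shows "pair_graph (cycle_graph m)"
proof -
  have fin: "finite (parcs (cycle_graph m))"
    by (rule finite_subset[of _ "{..<m} \<times> {..<m}"]) (auto simp: cycle_graph_def)
  have "i \<noteq> Suc i mod m" if "i < m" for i
    using assms that by (cases "Suc i = m") auto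
  then have "fst e \<noteq> snd e" if "e \<in> parcs (cycle_graph m)" for e
    using that by (fastforce simp: cycle_graph_def)
  moreover have "sym (parcs (cycle_graph m))"
    by (rule symI) (auto simp: cycle_graph_def)
  moreover have "fst e \<in> pverts (cycle_graph m)" "snd e \<in> pverts (cycle_graph m)"
    if "e \<in> parcs (cycle_graph m)" for e
    using that by (auto simp: cycle_graph_def)
  moreover have "finite (pverts (cycle_graph m))"
    by (simp add: cycle_graph_def)
  ultimately show ?thesis using fin
    by unfold_locales (simp_all add: symmetric_def)
qed

lemma pair_graph_cartesian_product:
  assumes "pair_graph G" "pair_graph H"
  shows "pair_graph (G \<box> H)"
proof -
  interpret G: pair_graph G by fact
  interpret H: pair_graph H by fact
  have fin: "finite (pverts (G \<box> H))"
    by (simp add: cartesian_product_def)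
  have "finite (parcs (G \<box> H))"
    by (rule finite_subset[of _ "(pverts G \<times> pverts H) \<times> (pverts G \<times> pverts H)"])
      (auto simp: cartesian_product_def)
  moreover have "sym (parcs G)" "sym (parcs H)"
    using G.pair_sym_arcs H.pair_sym_arcs by (simp_all add: symmetric_def)
  ultimately show ?thesis using fin
    by unfold_locales
      (auto simp: cartesian_product_def symmetric_def intro!: symI
        dest: G.no_loops' H.no_loops' symD)
qed

lemma pair_graph_stacked_prism: "m \<ge> 3 \<Longrightarrow> pair_graph (stacked_prism m n)"
  unfolding stacked_prism_def
  by (intro pair_graph_cartesian_product pair_graph_cycle pair_graph_path)

lemma connected_stacked_prism:
  assumes "m \<ge> 3" "n \<ge> 1"
  shows "connected (stacked_prism m n)"
proof -
  let ?G = "stacked_prism m n"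
  interpret pair_graph ?G by (rule pair_graph_stacked_prism) fact
  have arc: "u \<rightarrow>\<^sup>*\<^bsub>with_proj ?G\<^esub> v" if "(u, v) \<in> parcs ?G" for u v
    using that by (intro reachable_adjI) (simp add: with_proj_simps)
  have row: "(0, 0) \<rightarrow>\<^sup>*\<^bsub>with_proj ?G\<^esub> (i, 0)" if "i < m" for i
    using that
  proof (induction i)
    case 0
    then show ?case using assms
      by (intro reachable_refl) (auto simp: stacked_prism_def cartesian_product_def
          cycle_graph_def path_graph_def)
  next
    case (Suc i)
    have "((i, 0), (Suc i, 0)) \<in> parcs ?G"
      using Suc.prems assms
      by (auto simp: stacked_prism_def cartesian_product_def cycle_graph_def path_graph_def)
    with Suc show ?case using arc reachable_trans by (meson Suc_lessD)
  qed
  have col: "(0, 0) \<rightarrow>\<^sup>*\<^bsub>with_proj ?G\<^esub> (i, j)" if "i < m" "j < n" for i j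
    using that
  proof (induction j)
    case 0
    then show ?case using row by simp
  next
    case (Suc j)
    have "((i, j), (i, Suc j)) \<in> parcs ?G"
      using Suc.prems
      by (auto simp: stacked_prism_def cartesian_product_def cycle_graph_def path_graph_def)
    with Suc show ?case using arc reachable_trans by (meson Suc_lessD)
  qed
  have all: "(0, 0) \<rightarrow>\<^sup>*\<^bsub>with_proj ?G\<^esub> v" if "v \<in> pverts ?G" for v
    using that col by (auto simp: stacked_prism_def cartesian_product_def cycle_graph_def
        path_graph_def)
  have "strongly_connected ?G"
    unfolding strongly_connected_def
  proof (intro conjI ballI)
    show "verts (with_proj ?G) \<noteq> {}"
      using assms by (auto simp: stacked_prism_def cartesian_product_def cycle_graph_def
          path_graph_def lessThan_empty_iff)
    fix u v assume "u \<in> verts (with_proj ?G)" "v \<in> verts (with_proj ?G)"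
    then have "(0, 0) \<rightarrow>\<^sup>*\<^bsub>with_proj ?G\<^esub> u" "(0, 0) \<rightarrow>\<^sup>*\<^bsub>with_proj ?G\<^esub> v"
      using all by simp_all
    then show "u \<rightarrow>\<^sup>*\<^bsub>with_proj ?G\<^esub> v"
      using symmetric_reachable[OF pair_sym_arcs] reachable_trans by blast
  qed
  moreover have "(parcs ?G)\<^sup>s = parcs ?G"
    using pair_sym_arcs by (auto simp: symcl_def symmetric_def dest: symD)
  ultimately show ?thesis
    by (simp add: connected_conv strongly_connected_def reachable_def)
qed

lemma lookup_chip_fire:
  assumes "pair_graph G"
  shows "Poly_Mapping.lookup (chip_fire G w D) v =
    Poly_Mapping.lookup D v - (if v = w then int (out_degree G w) else 0)
      + (if (w, v) \<in> parcs G then 1 else 0)"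
proof -
  interpret pair_graph G by fact
  have fin: "finite {u. (w, u) \<in> parcs G}"
    by (rule finite_subset[OF _ pair_finite_verts]) (auto dest: in_arcsD2)
  have "(\<Sum>u | (w, u) \<in> parcs G. Poly_Mapping.lookup (frag_of u) v)
      = (\<Sum>u | (w, u) \<in> parcs G. if u = v then 1 else 0)"
    by (intro sum.cong) (auto simp: lookup_single when_def)
  also have "\<dots> = (if (w, v) \<in> parcs G then 1 else 0)"
    using fin by simp
  finally show ?thesis
    by (simp add: chip_fire_def lookup_add lookup_minus lookup_sum lookup_single when_def)
qed

lemma out_degree_eq_card:
  "out_degree (with_proj G) w = card {u. (w, u) \<in> parcs G}"
proof -
  have "out_arcs (with_proj G) w = Pair w ` {u. (w, u) \<in> parcs G}"
    by (auto simp: out_arcs_def)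
  then show ?thesis
    by (simp add: out_degree_def card_image inj_on_def)
qed

lemma chip_fire_in_Div:
  assumes "pair_graph G" "w \<in> pverts G" "D \<in> Div G"
  shows "chip_fire G w D \<in> Div G"
proof -
  interpret pair_graph G by fact
  have "Poly_Mapping.lookup (chip_fire G w D) v = 0" if "v \<notin> pverts G" for v
    using assms that
    by (auto simp: lookup_chip_fire Div_def in_keys_iff subset_iff dest: in_arcsD2)
  then show ?thesis by (auto simp: Div_def in_keys_iff)
qed

lemma div_deg_chip_fire:
  assumes "pair_graph G" "w \<in> pverts G"
  shows "div_deg G (chip_fire G w D) = div_deg G D"
proof -
  interpret pair_graph G by fact
  have "{v \<in> pverts G. (w, v) \<in> parcs G} = {u. (w, u) \<in> parcs G}"
    by (auto dest: in_arcsD2)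
  then have "(\<Sum>v\<in>pverts G. if (w, v) \<in> parcs G then 1 else (0::int)) = int (out_degree G w)"
    by (simp add: sum.If_cases out_degree_eq_card Int_def)
  then show ?thesis
    using assms by (simp add: div_deg_def lookup_chip_fire sum.distrib sum_subtractf)
qed

lemma chip_equiv_refl: "chip_equiv G D D"
  by (simp add: chip_equiv_def)

lemma chip_equiv_trans: "chip_equiv G D D' \<Longrightarrow> chip_equiv G D' D'' \<Longrightarrow> chip_equiv G D D''"
  unfolding chip_equiv_def by (rule rtranclp_trans)

lemma chip_equiv_deg_Div:
  assumes "pair_graph G" "chip_equiv G D D'"
  shows "div_deg G D' = div_deg G D" and "D \<in> Div G \<Longrightarrow> D' \<in> Div G"
proof -
  from assms(2) have "div_deg G D' = div_deg G D \<and> (D \<in> Div G \<longrightarrow> D' \<in> Div G)"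
    unfolding chip_equiv_def
    by (induction rule: rtranclp_induct)
      (auto simp: div_deg_chip_fire[OF assms(1)] chip_fire_in_Div[OF assms(1)])
  then show "div_deg G D' = div_deg G D" and "D \<in> Div G \<Longrightarrow> D' \<in> Div G" by auto
qed

text \<open>Firing each vertex of a set \<open>S\<close> once.\<close>

lemma chip_equiv_fire_set:
  assumes "finite S" "S \<subseteq> pverts G"
  shows "chip_equiv G D (D + (\<Sum>w\<in>S. chip_fire G w 0))"
  using assms
proof (induction S rule: finite_induct)
  case empty
  then show ?case by (simp add: chip_equiv_refl)
next
  case (insert w S)
  have "chip_fire G w (D + (\<Sum>w\<in>S. chip_fire G w 0)) = D + (\<Sum>w\<in>insert w S. chip_fire G w 0)"
  proof -
    have "chip_fire G w (D + X) = D + (chip_fire G w 0 + X)" for X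
      by (simp only: chip_fire_def diff_conv_add_uminus add_0 add_ac)
    then show ?thesis using insert.hyps by simp
  qed
  moreover have "chip_equiv G D (D + (\<Sum>w\<in>S. chip_fire G w 0))" using insert by auto
  ultimately show ?case
    using insert.prems unfolding chip_equiv_def
    by (metis (mono_tags, lifting) insert_subset rtranclp.rtrancl_into_rtrancl)
qed

lemma fire_all_vertices:
  assumes "pair_graph G"
  shows "(\<Sum>w\<in>pverts G. chip_fire G w 0) = 0"
proof (rule poly_mapping_eqI)
  fix v
  interpret pair_graph G by fact
  have in_out: "{w \<in> pverts G. (w, v) \<in> parcs G} = {u. (v, u) \<in> parcs G}"
    using pair_sym_arcs by (auto simp: symmetric_def dest: symD in_arcsD1 in_arcsD2)
  have "(\<Sum>w\<in>pverts G. if (w, v) \<in> parcs G then 1 else (0::int)) = int (out_degree G v)"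
    using in_out by (simp add: sum.If_cases out_degree_eq_card Int_def)
  moreover have "(\<Sum>w\<in>pverts G. if v = w then int (out_degree G w) else 0) =
      (if v \<in> pverts G then int (out_degree G v) else 0)"
    by simp
  moreover have "out_degree G v = 0" if "v \<notin> pverts G"
  proof -
    have "{u. (v, u) \<in> parcs G} = {}" using that by (auto dest: in_arcsD1)
    then show ?thesis by (simp add: out_degree_eq_card)
  qed
  ultimately show "Poly_Mapping.lookup (\<Sum>w\<in>pverts G. chip_fire G w 0) v =
      Poly_Mapping.lookup 0 v"
    using assms by (auto simp: lookup_sum lookup_chip_fire sum.distrib sum_subtractf)
qed

lemma chip_equiv_sym:
  assumes "pair_graph G" "chip_equiv G D D'"
  shows "chip_equiv G D' D"
  using assms(2) unfolding chip_equiv_def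
proof (induction rule: rtranclp_induct)
  case base
  then show ?case by simp
next
  case (step D' D'')
  interpret pair_graph G by fact
  from step obtain w where w: "w \<in> pverts G" "D'' = chip_fire G w D'" by auto
  have "chip_fire G w 0 + (\<Sum>w\<in>pverts G - {w}. chip_fire G w 0) = 0"
    using w(1) fire_all_vertices[OF assms(1)]
      sum.remove[OF pair_finite_verts w(1), of "\<lambda>w. chip_fire G w 0"] by simp
  moreover have "D'' = D' + chip_fire G w 0"
    using w(2) by (simp add: chip_fire_def)
  ultimately have "D'' + (\<Sum>w\<in>pverts G - {w}. chip_fire G w 0) = D'"
    by (simp add: add.assoc)
  then have "chip_equiv G D'' D'"
    using chip_equiv_fire_set[of "pverts G - {w}" G D''] by auto
  with step.IH show ?case unfolding chip_equiv_def by simp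
qed

lemma rank_at_least_le_deg:
  assumes "pair_graph G" "pverts G \<noteq> {}" "rank_at_least G D r"
  shows "int r \<le> div_deg G D"
proof -
  interpret pair_graph G by fact
  from assms obtain v where v: "v \<in> pverts G" by blast
  define E where "E = Poly_Mapping.single v (int r)"
  have "effective G E" "div_deg G E = int r"
    using v by (auto simp: E_def effective_def Div_def div_deg_def lookup_single when_def)
  with assms(3) obtain D' where D': "effective G D'" "chip_equiv G (D - E) D'"
    unfolding rank_at_least_def by blast
  have "0 \<le> div_deg G D'"
    using D'(1) by (auto simp: effective_def div_deg_def intro: sum_nonneg)
  also have "div_deg G D' = div_deg G D - div_deg G E"
    using chip_equiv_deg_Div(1)[OF assms(1) D'(2)]
    by (simp add: div_deg_def lookup_minus sum_subtractf)
  finally show ?thesis using \<open>div_deg G E = int r\<close> by simp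
qed

end

theory Submission
  imports Defs
begin

text \<open>Upper bound: one chip on every vertex of a copy of \<open>C\<^sub>m\<close> can be swept along the path, and
  one chip on every vertex of two adjacent copies of \<open>P\<^sub>n\<close> can be swept around the cycle.

  Lower bound: a scramble argument whose eggs are the \<open>m\<close> copies of \<open>P\<^sub>n\<close>. Among the effective
  divisors equivalent to one of rank at least one, take one hitting as many eggs as possible.
  If its degree is less than \<open>m\<close>, some egg \<open>A\<close> is missed; moving a chip onto \<open>A\<close> by firing level
  sets must uncover an egg \<open>B\<close> that was hit before. Then some fired set contains \<open>B\<close> and avoids
  \<open>A\<close>, so it has at least two outgoing edges in each of the \<open>n\<close> copies of \<open>C\<^sub>m\<close>, and each of
  these \<open>2n\<close> edges carries a chip.\<close>

section \<open>The graph Laplacian\<close>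

text \<open>Firing each \<open>v\<close> \<open>f v\<close> times changes \<open>D\<close> into
  \<open>D - laplacian G f\<close>. Written as a sum of differences, it lets truncations of
  \<open>f\<close> be compared arc by arc.\<close>

definition laplacian :: "'a pair_pre_digraph \<Rightarrow> ('a \<Rightarrow> int) \<Rightarrow> 'a \<Rightarrow> int" where
  "laplacian G f v = (\<Sum>u | (v, u) \<in> parcs G. f v - f u)"

lemma laplacian_const [simp]: "laplacian G (\<lambda>_. c) v = 0"
  by (simp add: laplacian_def)

lemma laplacian_add: "laplacian G (\<lambda>v. f v + g v) v = laplacian G f v + laplacian G g v"
  by (simp add: laplacian_def sum.distrib[symmetric] algebra_simps)

lemma laplacian_diff: "laplacian G (\<lambda>v. f v - g v) v = laplacian G f v - laplacian G g v"
  by (simp add: laplacian_def sum_subtractf[symmetric] algebra_simps)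

lemma laplacian_sum: "laplacian G (\<lambda>v. \<Sum>w\<in>S. f w v) v = (\<Sum>w\<in>S. laplacian G (f w) v)"
  by (simp add: laplacian_def sum_subtractf[symmetric] sum.swap[of _ S])

context pair_graph
begin

lemma finite_neighbours: "finite {u. (v, u) \<in> parcs G}"
  by (rule finite_subset[OF _ pair_finite_verts]) (auto dest: in_arcsD2)

lemma arc_sym: "(u, v) \<in> parcs G \<Longrightarrow> (v, u) \<in> parcs G"
  using pair_sym_arcs by (auto simp: symmetric_def dest: symD)

lemma laplacian_indicator:
  "laplacian G (\<lambda>v. of_bool (v = w)) v =
    (if v = w then int (out_degree G w) else 0) - (if (w, v) \<in> parcs G then 1 else 0)"
proof (cases "v = w")
  case True
  have "laplacian G (\<lambda>v. of_bool (v = w)) v = (\<Sum>u | (w, u) \<in> parcs G. 1)"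
    unfolding laplacian_def True using no_loops' by (intro sum.cong) auto
  then show ?thesis using True no_loops' by (auto simp: out_degree_eq_card)
next
  case False
  have "laplacian G (\<lambda>v. of_bool (v = w)) v = (\<Sum>u | (v, u) \<in> parcs G. if u = w then -1 else 0)"
    unfolding laplacian_def using False by (intro sum.cong) auto
  then show ?thesis using False finite_neighbours arc_sym by auto
qed

lemma lookup_chip_fire_laplacian:
  "Poly_Mapping.lookup (chip_fire G w D) v =
    Poly_Mapping.lookup D v - laplacian G (\<lambda>v. of_bool (v = w)) v"
  by (simp add: lookup_chip_fire[OF pair_graph_axioms] laplacian_indicator)

lemma lookup_fire_set:
  assumes "finite S"
  shows "Poly_Mapping.lookup (D + (\<Sum>w\<in>S. chip_fire G w 0)) v =
    Poly_Mapping.lookup D v - laplacian G (\<lambda>v. of_bool (v \<in> S)) v"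
proof -
  have "(\<lambda>v. of_bool (v \<in> S)) = (\<lambda>v. \<Sum>w\<in>S. of_bool (v = w) :: int)"
    using assms by (auto simp: fun_eq_iff of_bool_def)
  then show ?thesis
    by (simp add: lookup_add lookup_sum lookup_chip_fire_laplacian laplacian_sum sum_negf)
qed

text \<open>The script \<open>f\<close> counts how often each vertex is fired along the sequence of
  moves.\<close>

lemma chip_equiv_imp_laplacian:
  assumes "chip_equiv G D D'"
  obtains f where
    "\<And>v. Poly_Mapping.lookup D' v = Poly_Mapping.lookup D v - laplacian G f v"
proof -
  from assms have "\<exists>f. \<forall>v. Poly_Mapping.lookup D' v = Poly_Mapping.lookup D v - laplacian G f v"
    unfolding chip_equiv_def
  proof (induction rule: rtranclp_induct)
    case base
    show ?case by (rule exI[of _ "\<lambda>_. 0"]) simp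
  next
    case (step D' D'')
    then obtain f w where
      "\<forall>v. Poly_Mapping.lookup D' v = Poly_Mapping.lookup D v - laplacian G f v"
      "D'' = chip_fire G w D'" by blast
    then show ?case
      by (intro exI[of _ "\<lambda>v. f v + of_bool (v = w)"])
        (simp add: lookup_chip_fire_laplacian laplacian_add)
  qed
  then show ?thesis using that by blast
qed

lemma chip_equiv_imp_laplacian_diff:
  assumes "chip_equiv G (D - E) D'"
  obtains f where
    "\<And>v. Poly_Mapping.lookup D' v + Poly_Mapping.lookup E v
      = Poly_Mapping.lookup D v - laplacian G f v"
proof -
  obtain f where
    "\<And>v. Poly_Mapping.lookup D' v = Poly_Mapping.lookup (D - E) v - laplacian G f v"
    using chip_equiv_imp_laplacian[OF assms] by blast
  then have "Poly_Mapping.lookup D' v + Poly_Mapping.lookup E v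
      = Poly_Mapping.lookup D v - laplacian G f v" for v
    by (simp add: lookup_minus)
  then show ?thesis using that by blast
qed

text \<open>The two arcs of an edge contribute opposite amounts, so applying a script preserves the
  degree.\<close>

lemma sum_laplacian: "(\<Sum>v\<in>pverts G. laplacian G f v) = 0"
proof -
  have arcs: "Sigma (pverts G) (\<lambda>v. {u. (v, u) \<in> parcs G}) = parcs G"
    by (auto dest: in_arcsD1)
  have "(\<Sum>v\<in>pverts G. laplacian G f v) = (\<Sum>(v, u)\<in>parcs G. f v - f u)"
    unfolding laplacian_def using finite_neighbours
    by (subst sum.Sigma) (auto simp: arcs)
  also have "\<dots> = (\<Sum>(v, u)\<in>parcs G. f v) - (\<Sum>(v, u)\<in>parcs G. f u)"
    by (simp add: sum_subtractf case_prod_unfold)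
  also have "(\<Sum>(v, u)\<in>parcs G. f u) = (\<Sum>(v, u)\<in>parcs G. f v)"
    by (rule sum.reindex_bij_witness[of _ prod.swap prod.swap]) (auto intro: arc_sym)
  finally show ?thesis by simp
qed

text \<open>Raising the values below \<open>t\<close> to \<open>t\<close> lowers the difference
  towards each such neighbour by at least one, by integrality, and keeps the other differences. So
  compared with the full script, \<open>v\<close> retains an extra chip for every edge leading below
  the threshold.\<close>

lemma laplacian_max_above:
  assumes "t \<le> f v"
  shows "laplacian G (\<lambda>v. max (f v) t) v + int (card {u. (v, u) \<in> parcs G \<and> f u < t})
    \<le> laplacian G f v"
proof -
  have "int (card {u. (v, u) \<in> parcs G \<and> f u < t})
      = (\<Sum>u | (v, u) \<in> parcs G. of_bool (f u < t))"
    using finite_neighbours by (simp add: Int_def of_bool_def sum.If_cases)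
  then show ?thesis
    unfolding laplacian_def sum.distrib[symmetric]
    using assms by (auto simp: sum.distrib[symmetric] intro!: sum_mono)
qed

text \<open>The truncated value at \<open>v\<close> is \<open>t\<close>, a minimum of the truncated
  script, so \<open>v\<close> only gains chips, at least one across each edge from above the
  threshold.\<close>

lemma laplacian_max_below:
  assumes "f v \<le> t"
  shows "laplacian G (\<lambda>v. max (f v) t) v + int (card {u. (v, u) \<in> parcs G \<and> t < f u}) \<le> 0"
proof -
  have "int (card {u. (v, u) \<in> parcs G \<and> t < f u})
      = (\<Sum>u | (v, u) \<in> parcs G. of_bool (t < f u))"
    using finite_neighbours by (simp add: Int_def of_bool_def sum.If_cases)
  then show ?thesis
    unfolding laplacian_def
    using assms by (auto simp: sum.distrib[symmetric] intro!: sum_nonpos)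
qed

lemma neighbour_card_pos: "(v, u) \<in> parcs G \<Longrightarrow> P u \<Longrightarrow> 0 < card {u. (v, u) \<in> parcs G \<and> P u}"
  using finite_neighbours by (subst card_gt_0_iff) auto

end


section \<open>Rank at least one\<close>

lemma chip_equiv_add_right:
  assumes "chip_equiv G D D'"
  shows "chip_equiv G (D + X) (D' + X)"
  using assms unfolding chip_equiv_def
proof (induction rule: rtranclp_induct)
  case (step D' D'')
  then obtain w where "w \<in> pverts G" "D'' = chip_fire G w D'" by blast
  then have "\<exists>w\<in>pverts G. D'' + X = chip_fire G w (D' + X)"
    by (intro bexI[of _ w]) (simp_all add: chip_fire_def algebra_simps)
  with step.IH show ?case by (rule rtranclp.rtrancl_into_rtrancl)
qed simp

context pair_graph
begin

lemma rank_at_least_bounded: "pverts G \<noteq> {} \<Longrightarrow> rank_at_least G D r \<Longrightarrow> r \<le> nat (div_deg G D)"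
  using rank_at_least_le_deg[OF pair_graph_axioms, of D r] by linarith

text \<open>With \<open>r\<close> the exact rank, possibly above one, subtract \<open>r\<close>
  chips at \<open>v\<close>, pass to an effective divisor and add the \<open>r\<close> chips back:
  the result is effective with a chip at \<open>v\<close>.\<close>

lemma div_rank_ge_1_imp:
  assumes "pverts G \<noteq> {}" "1 \<le> div_rank G D" "v \<in> pverts G"
  obtains g f where "\<And>u. u \<in> pverts G \<Longrightarrow> 0 \<le> g u" "0 < g v"
    "\<And>u. g u = Poly_Mapping.lookup D u - laplacian G f u"
proof -
  define r where "r = (GREATEST r. rank_at_least G D r)"
  have ex: "\<exists>r. rank_at_least G D r" and r: "1 \<le> r"
    using assms(2) by (auto simp: div_rank_def r_def split: if_splits)
  have "rank_at_least G D r"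
    unfolding r_def using ex rank_at_least_bounded[OF assms(1)] by (metis GreatestI_ex_nat)
  moreover have "effective G (Poly_Mapping.single v (int r))"
    "div_deg G (Poly_Mapping.single v (int r)) = int r"
    using assms(3) by (auto simp: effective_def Div_def div_deg_def lookup_single when_def)
  ultimately obtain D' where D': "effective G D'"
    "chip_equiv G (D - Poly_Mapping.single v (int r)) D'"
    unfolding rank_at_least_def by blast
  obtain f where f: "\<And>u. Poly_Mapping.lookup D' u
      + Poly_Mapping.lookup (Poly_Mapping.single v (int r)) u
      = Poly_Mapping.lookup D u - laplacian G f u"
    using chip_equiv_imp_laplacian_diff[OF D'(2)] by blast
  show ?thesis
    using D'(1) r assms(3)
    by (intro that[OF _ _ f])
      (auto simp: effective_def lookup_single when_def intro!: add_nonneg_pos)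
qed

text \<open>An effective divisor of degree one is a single generator \<open>(v)\<close>, and a
  divisor with a chip at \<open>v\<close> stays effective when that chip is removed.\<close>

lemma div_rank_ge_1I:
  assumes "pverts G \<noteq> {}"
    and cover: "\<And>v. v \<in> pverts G \<Longrightarrow>
      \<exists>D'. effective G D' \<and> chip_equiv G D D' \<and> 0 < Poly_Mapping.lookup D' v"
  shows "1 \<le> div_rank G D"
proof -
  have "rank_at_least G D 1"
    unfolding rank_at_least_def
  proof (intro allI impI)
    fix E assume E: "effective G E \<and> div_deg G E = int 1"
    have "\<exists>v\<in>pverts G. 0 < Poly_Mapping.lookup E v"
    proof (rule ccontr)
      assume "\<not> ?thesis"
      then have "div_deg G E \<le> 0"
        unfolding div_deg_def by (intro sum_nonpos) force
      with E show False by simp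
    qed
    then obtain v where v: "v \<in> pverts G" "0 < Poly_Mapping.lookup E v" by blast
    have rest: "(\<Sum>u\<in>pverts G - {v}. Poly_Mapping.lookup E u) = 1 - Poly_Mapping.lookup E v"
      using E v(1) by (simp add: div_deg_def sum.remove)
    have nonneg: "\<And>u. u \<in> pverts G - {v} \<Longrightarrow> 0 \<le> Poly_Mapping.lookup E u"
      using E by (simp add: effective_def)
    then have "0 \<le> (\<Sum>u\<in>pverts G - {v}. Poly_Mapping.lookup E u)"
      by (rule sum_nonneg)
    then have E1: "Poly_Mapping.lookup E v = 1" using rest v(2) by simp
    then have E0: "Poly_Mapping.lookup E u = 0" if "u \<in> pverts G" "u \<noteq> v" for u
      using rest nonneg that sum_nonneg_eq_0_iff[of "pverts G - {v}" "Poly_Mapping.lookup E"] by simp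
    obtain D' where D': "effective G D'" "chip_equiv G D D'" "0 < Poly_Mapping.lookup D' v"
      using cover v(1) by blast
    have "chip_equiv G (D - E) (D' - E)"
      using chip_equiv_add_right[OF D'(2), of "- E"] by simp
    moreover have "effective G (D' - E)"
    proof -
      have "0 \<le> Poly_Mapping.lookup (D' - E) u" if "u \<in> pverts G" for u
        using that D' E1 E0[OF that]
        by (cases "u = v") (auto simp: effective_def lookup_minus)
      moreover have "Poly_Mapping.keys (D' - E) \<subseteq> pverts G"
        using D'(1) E keys_diff[of D' E] by (auto simp: effective_def Div_def)
      ultimately show ?thesis by (simp add: effective_def Div_def)
    qed
    ultimately show "\<exists>D'. effective G D' \<and> chip_equiv G (D - E) D'" by blast
  qed
  then have "1 \<le> (GREATEST r. rank_at_least G D r)"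
    using rank_at_least_bounded[OF assms(1)] by (intro Greatest_le_nat) auto
  with \<open>rank_at_least G D 1\<close> show ?thesis by (auto simp: div_rank_def)
qed

end

section \<open>Scrambles\<close>

text \<open>The scramble number bound with eggs \<E>: \<open>conn\<close> says that eggs induce
  connected subgraphs, \<open>hit\<close> that a hitting set has at least \<open>k\<close> vertices,
  and \<open>cut\<close> that an edge cut separating two eggs has at least \<open>k\<close>
  edges.\<close>

lemma (in pair_graph) scramble_le_deg:
  fixes k :: nat
  assumes ne: "\<E> \<noteq> {}"
    and sub: "\<And>A. A \<in> \<E> \<Longrightarrow> A \<subseteq> pverts G \<and> A \<noteq> {}"
    and conn: "\<And>A W. \<lbrakk>A \<in> \<E>; A \<inter> W \<noteq> {}; A - W \<noteq> {}\<rbrakk> \<Longrightarrow>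
      \<exists>u\<in>A \<inter> W. \<exists>v\<in>A - W. (u, v) \<in> parcs G"
    and hit: "\<And>H. \<lbrakk>H \<subseteq> pverts G; card H < k\<rbrakk> \<Longrightarrow> \<exists>A\<in>\<E>. A \<inter> H = {}"
    and cut: "\<And>A B U. \<lbrakk>A \<in> \<E>; B \<in> \<E>; U \<subseteq> pverts G; A \<subseteq> U; B \<inter> U = {}\<rbrakk> \<Longrightarrow>
      k \<le> card {(u, v) \<in> parcs G. u \<in> U \<and> v \<notin> U}"
    and rank: "1 \<le> div_rank G D"
  shows "int k \<le> div_deg G D"
proof (rule ccontr)
  assume "\<not> ?thesis"
  then have deg: "div_deg G D < int k" by simp
  have fin: "finite \<E>"
    by (rule finite_subset[of _ "Pow (pverts G)"]) (use sub in auto)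
  \<comment> \<open>The effective divisors reached from \<open>D\<close> by firing scripts, kept as
    functions so that truncated scripts apply directly.\<close>
  define F where "F = {g. (\<forall>v\<in>pverts G. 0 \<le> g v) \<and>
    (\<exists>f. \<forall>v. g v = Poly_Mapping.lookup D v - laplacian G f v)}"
  have nonneg: "0 \<le> g v" if "g \<in> F" "v \<in> pverts G" for g v
    using that by (simp add: F_def)
  have sum_F: "(\<Sum>v\<in>pverts G. g v) = div_deg G D" if "g \<in> F" for g
    using that by (auto simp: F_def div_deg_def sum_subtractf sum_laplacian)
  obtain v0 where v0: "v0 \<in> pverts G" using ne sub by blast
  have cover: "\<exists>g\<in>F. 0 < g v" if "v \<in> pverts G" for v
  proof -
    from v0 have "pverts G \<noteq> {}" by blast
    from div_rank_ge_1_imp[OF this rank that] obtain g f where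
      "\<And>u. u \<in> pverts G \<Longrightarrow> 0 \<le> g u" "0 < g v"
      "\<And>u. g u = Poly_Mapping.lookup D u - laplacian G f u" by blast
    then show ?thesis by (intro bexI[of _ g]) (auto simp: F_def)
  qed
  define hits where "hits g = {A \<in> \<E>. \<exists>v\<in>A. 0 < g v}" for g :: "'a \<Rightarrow> int"
  obtain g where g: "g \<in> F" and max_hits: "\<And>g'. g' \<in> F \<Longrightarrow> card (hits g') \<le> card (hits g)"
  proof -
    obtain g0 where "g0 \<in> F" using cover v0 by blast
    moreover have "card (hits g') < Suc (card \<E>)" for g'
      using card_mono[OF fin, of "hits g'"] by (auto simp: hits_def le_imp_less_Suc)
    ultimately show ?thesis
      using ex_has_greatest_nat[of "\<lambda>g. g \<in> F" g0 "\<lambda>g. card (hits g)"] that by metis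
  qed
  define H where "H = {v \<in> pverts G. 0 < g v}"
  \<comment> \<open>Each vertex of the support carries a chip, so the support has fewer than
    \<open>k\<close> vertices and cannot hit every egg.\<close>
  have "int (card H) = (\<Sum>v\<in>H. 1)" by simp
  also have "\<dots> \<le> (\<Sum>v\<in>H. g v)" by (rule sum_mono) (auto simp: H_def)
  also have "\<dots> \<le> (\<Sum>v\<in>pverts G. g v)"
    using nonneg[OF g] by (intro sum_mono2) (auto simp: H_def)
  finally have "card H < k" using sum_F[OF g] deg by simp
  then obtain A where A: "A \<in> \<E>" "A \<inter> H = {}"
    using hit[of H] by (auto simp: H_def)
  then have A_not_hit: "A \<notin> hits g" using sub by (auto simp: hits_def H_def)
  obtain a where a: "a \<in> A" using A(1) sub by blast
  obtain g' where g': "g' \<in> F" "0 < g' a" using cover a A(1) sub by blast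
  obtain f where f: "\<And>v. g' v = g v - laplacian G f v"
  proof -
    obtain f1 f2 where
      "\<forall>v. g v = Poly_Mapping.lookup D v - laplacian G f1 v"
      "\<forall>v. g' v = Poly_Mapping.lookup D v - laplacian G f2 v"
      using g g'(1) by (auto simp: F_def)
    then show ?thesis
      by (intro that[of "\<lambda>v. f2 v - f1 v"]) (simp add: laplacian_diff)
  qed
  \<comment> \<open>Truncating the firing script \<open>f\<close> from below interpolates between \<open>g\<close> (large \<open>t\<close>) and \<open>g'\<close>
    (small \<open>t\<close>) through effective divisors; the step from \<open>h (t + 1)\<close> to \<open>h t\<close> fires \<open>{v. t < f v}\<close>.\<close>
  define h where "h t v = g v - laplacian G (\<lambda>v. max (f v) t) v" for t v
  have h_above: "g' v + int (card {u. (v, u) \<in> parcs G \<and> f u < t}) \<le> h t v"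
    if "t \<le> f v" for t v
    using laplacian_max_above[of t f v] that by (simp add: h_def f)
  have h_below: "g v + int (card {u. (v, u) \<in> parcs G \<and> t < f u}) \<le> h t v"
    if "f v \<le> t" for t v
    using laplacian_max_below[of f v t] that by (simp add: h_def)
  have h_F: "h t \<in> F" for t
  proof -
    obtain f1 where "\<forall>v. g v = Poly_Mapping.lookup D v - laplacian G f1 v"
      using g by (auto simp: F_def)
    then have "\<forall>v. h t v = Poly_Mapping.lookup D v - laplacian G (\<lambda>v. f1 v + max (f v) t) v"
      by (simp add: h_def laplacian_add)
    moreover have "0 \<le> h t v" if "v \<in> pverts G" for v
      using h_above[of t v] h_below[of v t] nonneg[OF g that] nonneg[OF g'(1) that]
      by (cases "t \<le> f v") auto
    ultimately show ?thesis unfolding F_def by blast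
  qed
  have finA: "finite A" using sub[OF A(1)] by (auto intro: finite_subset[OF _ pair_finite_verts])
  \<comment> \<open>\<open>t\<close> is the smallest threshold whose upper level set
    \<open>{v. t < f v}\<close> avoids \<open>A\<close>, so all sets fired on the way to
    \<open>h t\<close> avoid \<open>A\<close>.\<close>
  define t where "t = Max (f ` A)"
  have le_t: "f v \<le> t" if "v \<in> A" for v
    using that finA by (simp add: t_def)
  have "t \<in> f ` A" unfolding t_def using finA a by (intro Max_in) auto
  then obtain b where b: "b \<in> A" "f b = t" by auto
  \<comment> \<open>If \<open>a\<close> has height \<open>t\<close>, then it already holds at least
    \<open>g' a\<close> chips. Otherwise connectedness gives an edge inside \<open>A\<close> from
    height \<open>t\<close> to a lower vertex; its upper end is in the next set to be fired and must
    hold a chip for that edge.\<close>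
  have "A \<in> hits (h t)"
  proof (cases "f a = t")
    case True
    then have "0 < h t a" using h_above[of t a] g'(2) by simp
    then show ?thesis using A(1) a by (auto simp: hits_def)
  next
    case False
    then have "A \<inter> {v. f v = t} \<noteq> {}" "A - {v. f v = t} \<noteq> {}" using a b by auto
    from conn[OF A(1) this] obtain x y where
      xy: "x \<in> A" "f x = t" "y \<in> A" "f y \<noteq> t" "(x, y) \<in> parcs G" by blast
    then have "f y < t" using le_t[of y] by simp
    then have "0 < card {u. (x, u) \<in> parcs G \<and> f u < t}"
      using xy(5) by (rule neighbour_card_pos[rotated])
    moreover have "0 \<le> g' x" using nonneg[OF g'(1)] xy(1) sub A(1) by blast
    ultimately have "0 < h t x" using h_above[of t x] xy(2) by simp
    then show ?thesis using A(1) xy(1) by (auto simp: hits_def)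
  qed
  moreover have "hits g \<subseteq> hits (h t)"
  proof
    fix B assume "B \<in> hits g"
    then obtain z where B: "B \<in> \<E>" "z \<in> B" "0 < g z" by (auto simp: hits_def)
    define U where "U = {v \<in> pverts G. t < f v}"
    have "\<not> B \<subseteq> U"
    proof
      assume "B \<subseteq> U"
      moreover have "A \<inter> U = {}" using le_t by (force simp: U_def)
      moreover have "U \<subseteq> pverts G" by (auto simp: U_def)
      ultimately have "k \<le> card {(u, v) \<in> parcs G. u \<in> U \<and> v \<notin> U}"
        using cut[OF B(1) A(1)] by blast
      \<comment> \<open>By integrality the condition \<open>v \<notin> U\<close> becomes
        \<open>f v < t + 1\<close>, matching \<open>h_above\<close> at threshold
        \<open>t + 1\<close>: just before \<open>U\<close> is fired, every edge leaving
        \<open>U\<close> has its own chip.\<close>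
      also have "{(u, v) \<in> parcs G. u \<in> U \<and> v \<notin> U}
          = Sigma U (\<lambda>u. {v. (u, v) \<in> parcs G \<and> f v < t + 1})"
        by (auto simp: U_def dest: in_arcsD1 in_arcsD2)
      also have "card \<dots> = (\<Sum>u\<in>U. card {v. (u, v) \<in> parcs G \<and> f v < t + 1})"
        using finite_neighbours by (intro card_SigmaI) (auto simp: U_def)
      finally have "int k \<le> (\<Sum>u\<in>U. int (card {v. (u, v) \<in> parcs G \<and> f v < t + 1}))"
        by (simp flip: of_nat_sum)
      also have "\<dots> \<le> (\<Sum>u\<in>U. h (t + 1) u)"
      proof (rule sum_mono)
        fix u assume "u \<in> U"
        then show "int (card {v. (u, v) \<in> parcs G \<and> f v < t + 1}) \<le> h (t + 1) u"
          using h_above[of "t + 1" u] nonneg[OF g'(1), of u] by (auto simp: U_def)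
      qed
      also have "\<dots> \<le> (\<Sum>u\<in>pverts G. h (t + 1) u)"
        using nonneg[OF h_F] by (intro sum_mono2) (auto simp: U_def)
      also have "\<dots> = div_deg G D" by (rule sum_F[OF h_F])
      finally show False using deg by simp
    qed
    then obtain y0 where y0: "y0 \<in> B" "f y0 \<le> t" using sub[OF B(1)] by (force simp: U_def)
    \<comment> \<open>If \<open>z\<close> lies at height at most \<open>t\<close>, it has lost no
      chip. Otherwise \<open>B\<close> straddles the level, and an edge inside \<open>B\<close> has
      carried a chip down to \<open>y\<close>.\<close>
    show "B \<in> hits (h t)"
    proof (cases "f z \<le> t")
      case True
      then have "0 < h t z" using h_below[of z t] B(3) by simp
      then show ?thesis using B by (auto simp: hits_def)
    next
      case False
      then have "B \<inter> {v. t < f v} \<noteq> {}" "B - {v. t < f v} \<noteq> {}" using B y0 by auto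
      from conn[OF B(1) this] obtain x y where
        xy: "t < f x" "y \<in> B" "\<not> t < f y" "(x, y) \<in> parcs G" by blast
      have "0 < card {u. (y, u) \<in> parcs G \<and> t < f u}"
        using arc_sym[OF xy(4)] xy(1) by (rule neighbour_card_pos)
      moreover have "0 \<le> g y" using nonneg[OF g] xy(2) sub B(1) by blast
      ultimately have "0 < h t y" using h_below[of y t] xy(3) by simp
      then show ?thesis using B(1) xy(2) by (auto simp: hits_def)
    qed
  qed
  ultimately have "hits g \<subset> hits (h t)" using A_not_hit by blast
  moreover have "finite (hits (h t))" using fin by (simp add: hits_def)
  ultimately show False using max_hits[OF h_F, of t] psubset_card_mono[of "hits (h t)" "hits g"] by simp
qed


section \<open>Divisors of positive rank from firing sequences\<close>

context pair_graph
begin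

lemma laplacian_cong:
  assumes "\<And>u. u \<in> pverts G \<Longrightarrow> f u = g u" "v \<in> pverts G"
  shows "laplacian G f v = laplacian G g v"
  unfolding laplacian_def using assms by (intro sum.cong) (auto dest: in_arcsD2)

lemma exists_divisor:
  obtains D where "D \<in> Div G" "\<And>v. v \<in> pverts G \<Longrightarrow> Poly_Mapping.lookup D v = h v"
proof
  let ?D = "\<Sum>v\<in>pverts G. Poly_Mapping.single v (h v)"
  have lookup: "Poly_Mapping.lookup ?D v = (if v \<in> pverts G then h v else 0)" for v
    by (simp add: lookup_sum lookup_single when_def)
  show "?D \<in> Div G" unfolding Div_def by (auto simp: in_keys_iff lookup split: if_splits)
  show "Poly_Mapping.lookup ?D v = h v" if "v \<in> pverts G" for v
    using that by (simp add: lookup)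
qed

text \<open>Every configuration of the sweep is an effective divisor equivalent to the first, so one
  with a chip at \<open>v\<close> settles the rank condition at \<open>v\<close>.\<close>

lemma exists_positive_rank:
  assumes fire: "\<And>t v. t < N \<Longrightarrow> v \<in> pverts G \<Longrightarrow>
      h (Suc t) v = h t v - laplacian G (\<lambda>v. of_bool (v \<in> S t)) v"
    and sub: "\<And>t. t < N \<Longrightarrow> S t \<subseteq> pverts G"
    and nonneg: "\<And>t v. v \<in> pverts G \<Longrightarrow> 0 \<le> h t v"
    and cover: "\<And>v. v \<in> pverts G \<Longrightarrow> \<exists>t\<le>N. 0 < h t v"
    and ne: "pverts G \<noteq> {}"
  shows "\<exists>D\<in>Div G. div_deg G D = (\<Sum>v\<in>pverts G. h 0 v) \<and> 1 \<le> div_rank G D"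
proof -
  obtain D where D: "D \<in> Div G" "\<And>v. v \<in> pverts G \<Longrightarrow> Poly_Mapping.lookup D v = h 0 v"
    using exists_divisor[of "h 0"] by blast
  have seq: "\<exists>D'\<in>Div G. chip_equiv G D D' \<and> (\<forall>v\<in>pverts G. Poly_Mapping.lookup D' v = h t v)"
    if "t \<le> N" for t
    using that
  proof (induction t)
    case 0
    show ?case using D chip_equiv_refl by blast
  next
    case (Suc t)
    then obtain D' where D': "D' \<in> Div G" "chip_equiv G D D'"
      "\<forall>v\<in>pverts G. Poly_Mapping.lookup D' v = h t v" by auto
    let ?D = "D' + (\<Sum>w\<in>S t. chip_fire G w 0)"
    have S: "S t \<subseteq> pverts G" "finite (S t)"
      using sub[of t] Suc.prems by (auto intro: finite_subset[OF _ pair_finite_verts])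
    have "chip_equiv G D' ?D" using S by (intro chip_equiv_fire_set)
    moreover have "\<forall>v\<in>pverts G. Poly_Mapping.lookup ?D v = h (Suc t) v"
      using D'(3) fire[of t] Suc.prems by (simp add: lookup_fire_set[OF S(2)])
    ultimately show ?case
      using D' chip_equiv_trans chip_equiv_deg_Div(2)[OF pair_graph_axioms] by blast
  qed
  have "1 \<le> div_rank G D"
  proof (rule div_rank_ge_1I[OF ne])
    fix v assume v: "v \<in> pverts G"
    then obtain t where t: "t \<le> N" "0 < h t v" using cover by blast
    then obtain D' where "D' \<in> Div G" "chip_equiv G D D'"
      "\<forall>v\<in>pverts G. Poly_Mapping.lookup D' v = h t v" using seq by blast
    then show "\<exists>D'. effective G D' \<and> chip_equiv G D D' \<and> 0 < Poly_Mapping.lookup D' v"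
      using v t nonneg by (intro exI[of _ D']) (simp add: effective_def)
  qed
  then show ?thesis using D by (intro bexI[of _ D]) (simp_all add: div_deg_def)
qed

end

lemma gonality_eqI:
  assumes "\<exists>D\<in>Div G. div_deg G D = k \<and> 1 \<le> div_rank G D"
    and "\<And>D. D \<in> Div G \<Longrightarrow> 1 \<le> div_rank G D \<Longrightarrow> k \<le> div_deg G D"
  shows "gonality G = k"
  unfolding gonality_def using assms by (intro Least_equality) auto

section \<open>Paths, cycles and stacked prisms\<close>

text \<open>The neighbours of \<open>(v, w)\<close> split into those in its copy of \<open>G\<close>
  and those in its copy of \<open>H\<close>; absence of loops makes the two kinds disjoint.\<close>

lemma laplacian_cartesian_product:
  assumes "pair_graph G" "pair_graph H" "v \<in> pverts G" "w \<in> pverts H"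
  shows "laplacian (G \<box> H) f (v, w) =
    laplacian G (\<lambda>u. f (u, w)) v + laplacian H (\<lambda>u. f (v, u)) w"
proof -
  interpret G: pair_graph G by fact
  interpret H: pair_graph H by fact
  have "{x. ((v, w), x) \<in> parcs (G \<box> H)}
      = (\<lambda>u. (u, w)) ` {u. (v, u) \<in> parcs G} \<union> Pair v ` {u. (w, u) \<in> parcs H}"
    using assms(3,4) by (auto simp: cartesian_product_def dest: G.in_arcsD2 H.in_arcsD2)
  moreover have "(\<lambda>u. (u, w)) ` {u. (v, u) \<in> parcs G} \<inter> Pair v ` {u. (w, u) \<in> parcs H} = {}"
    by (auto dest: G.no_loops')
  ultimately show ?thesis
    using G.finite_neighbours[of v] H.finite_neighbours[of w]
    by (simp add: laplacian_def sum.union_disjoint sum.reindex inj_on_def)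
qed

text \<open>Only the edge between \<open>t\<close> and \<open>Suc t\<close> crosses the boundary of
  the initial segment.\<close>

lemma laplacian_path_initial:
  assumes "Suc t < n" "j < n"
  shows "laplacian (path_graph n) (\<lambda>j. of_bool (j \<le> t)) j = of_bool (j = t) - of_bool (j = Suc t)"
proof -
  have "laplacian (path_graph n) (\<lambda>j. of_bool (j \<le> t)) j =
    (\<Sum>u<n. if j = Suc u \<or> u = Suc j then of_bool (j \<le> t) - of_bool (u \<le> t) else 0)"
    unfolding laplacian_def using assms
    by (intro sum.mono_neutral_cong_left) (auto simp: path_graph_def)
  also have "\<dots> = (\<Sum>u<n. (if u = Suc t then of_bool (j = t) else 0)
      - (if u = t then of_bool (j = Suc t) else 0))"
    by (intro sum.cong) auto
  finally show ?thesis using assms by (simp add: sum_subtractf)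
qed

lemma Suc_mod_eq: "i < m \<Longrightarrow> Suc i mod m = (if Suc i = m then 0 else Suc i)"
  by auto

text \<open>The indicated set is an arc through the edge from \<open>m - 1\<close> to
  \<open>0\<close>, with boundary edges \<open>t\<close>, \<open>Suc t\<close> and \<open>s\<close>,
  \<open>Suc s\<close>. If \<open>s = Suc t\<close>, that vertex receives two chips.\<close>

lemma laplacian_cycle_arc:
  assumes "t < s" "Suc s < m" "i < m"
  shows "laplacian (cycle_graph m) (\<lambda>i. of_bool (i \<le> t \<or> s < i)) i =
    of_bool (i = t) + of_bool (i = Suc s) - of_bool (i = Suc t) - of_bool (i = s)"
proof -
  let ?f = "\<lambda>i. of_bool (i \<le> t \<or> s < i) :: int"
  have "laplacian (cycle_graph m) ?f i =
    (\<Sum>u<m. if u = Suc i mod m \<or> i = Suc u mod m then ?f i - ?f u else 0)"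
    unfolding laplacian_def using assms
    by (intro sum.mono_neutral_cong_left) (auto simp: cycle_graph_def)
  also have "\<dots> = (\<Sum>u<m. if u = Suc i \<or> i = Suc u then ?f i - ?f u else 0)"
  proof (rule sum.cong)
    fix u assume "u \<in> {..<m}"
    then show "(if u = Suc i mod m \<or> i = Suc u mod m then ?f i - ?f u else 0)
        = (if u = Suc i \<or> i = Suc u then ?f i - ?f u else 0)"
      using assms by (cases "Suc i = m"; cases "Suc u = m") auto
  qed simp
  also have "\<dots> = (\<Sum>u<m. (if u = Suc t then of_bool (i = t) else 0)
      + (if u = s then of_bool (i = Suc s) else 0)
      - (if u = t then of_bool (i = Suc t) else 0)
      - (if u = Suc s then of_bool (i = s) else 0))"
  proof (rule sum.cong)
    fix u
    consider "u = Suc i" | "i = Suc u" | "u \<noteq> Suc i" "i \<noteq> Suc u" by blast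
    then show "(if u = Suc i \<or> i = Suc u then ?f i - ?f u else 0)
      = (if u = Suc t then of_bool (i = t) else 0) + (if u = s then of_bool (i = Suc s) else 0)
      - (if u = t then of_bool (i = Suc t) else 0) - (if u = Suc s then of_bool (i = s) else 0)"
      using assms(1) by cases auto
  qed simp
  finally show ?thesis using assms by (simp add: sum_subtractf sum.distrib)
qed

lemma pverts_stacked_prism: "pverts (stacked_prism m n) = {..<m} \<times> {..<n}"
  by (simp add: stacked_prism_def cartesian_product_def cycle_graph_def path_graph_def)

lemma parcs_stacked_prism:
  "((i, j), (i', j')) \<in> parcs (stacked_prism m n) \<longleftrightarrow>
    i < m \<and> i' < m \<and> j < n \<and> j' < n \<and>
    (j = j' \<and> (i' = Suc i mod m \<or> i = Suc i' mod m) \<or> i = i' \<and> (j' = Suc j \<or> j = Suc j'))"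
  by (auto simp: stacked_prism_def cartesian_product_def cycle_graph_def path_graph_def)

lemma laplacian_stacked_prism:
  assumes "m \<ge> 3" "i < m" "j < n"
  shows "laplacian (stacked_prism m n) f (i, j) =
    laplacian (cycle_graph m) (\<lambda>i. f (i, j)) i + laplacian (path_graph n) (\<lambda>j. f (i, j)) j"
  unfolding stacked_prism_def using assms
  by (intro laplacian_cartesian_product pair_graph_cycle pair_graph_path)
    (auto simp: cycle_graph_def path_graph_def)

section \<open>Upper bound: sweeping copies of the cycle and of the path\<close>

lemma stacked_prism_rank_cycle_copy:
  assumes "m \<ge> 3" "n \<ge> 1"
  shows "\<exists>D\<in>Div (stacked_prism m n). div_deg (stacked_prism m n) D = int m \<and>
    1 \<le> div_rank (stacked_prism m n) D"
proof -
  let ?G = "stacked_prism m n"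
  interpret pair_graph ?G using assms(1) by (rule pair_graph_stacked_prism)
  define h :: "nat \<Rightarrow> nat \<times> nat \<Rightarrow> int" where "h t v = of_bool (snd v = t)" for t v
  have "\<exists>D\<in>Div ?G. div_deg ?G D = (\<Sum>v\<in>pverts ?G. h 0 v) \<and> 1 \<le> div_rank ?G D"
  \<comment> \<open>Firing copies \<open>0\<close> to \<open>t\<close> of the cycle moves all chips
    from copy \<open>t\<close> to copy \<open>Suc t\<close>; \<open>n - 1\<close> firings reach the
    last copy.\<close>
  proof (rule exists_positive_rank[where S = "\<lambda>t. {..<m} \<times> {..t}" and N = "n - 1"])
    fix t v assume t: "t < n - 1" and v: "v \<in> pverts ?G"
    then obtain i j where v_eq: "v = (i, j)" and ij: "i < m" "j < n"
      by (auto simp: pverts_stacked_prism)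
    have "laplacian ?G (\<lambda>v. of_bool (v \<in> {..<m} \<times> {..t})) v
        = laplacian ?G (\<lambda>v. of_bool (snd v \<le> t)) v"
      using v by (intro laplacian_cong) (auto simp: pverts_stacked_prism)
    then show "h (Suc t) v = h t v - laplacian ?G (\<lambda>v. of_bool (v \<in> {..<m} \<times> {..t})) v"
      using ij t assms(1)
      by (simp add: v_eq h_def laplacian_stacked_prism laplacian_path_initial)
  qed (use assms in \<open>auto simp: h_def pverts_stacked_prism lessThan_empty_iff\<close>)
  moreover have "(\<Sum>v\<in>pverts ?G. h 0 v) = int m"
    using assms by (simp add: pverts_stacked_prism h_def of_bool_def sum.cartesian_product')
  ultimately show ?thesis by simp
qed

lemma stacked_prism_rank_path_copies:
  assumes "m \<ge> 3" "n \<ge> 1"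
  shows "\<exists>D\<in>Div (stacked_prism m n). div_deg (stacked_prism m n) D = int (2 * n) \<and>
    1 \<le> div_rank (stacked_prism m n) D"
proof -
  let ?G = "stacked_prism m n"
  interpret pair_graph ?G using assms(1) by (rule pair_graph_stacked_prism)
  \<comment> \<open>The two loaded copies of the path start at the adjacent positions
    \<open>0\<close> and \<open>m - 1\<close> and move apart around the cycle.\<close>
  define h :: "nat \<Rightarrow> nat \<times> nat \<Rightarrow> int"
    where "h t v = of_bool (fst v = t) + of_bool (fst v = m - 1 - t)" for t v
  define S where "S t = {i. i < m \<and> (i \<le> t \<or> m - 2 - t < i)} \<times> {..<n}" for t
  have "\<exists>D\<in>Div ?G. div_deg ?G D = (\<Sum>v\<in>pverts ?G. h 0 v) \<and> 1 \<le> div_rank ?G D"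
  \<comment> \<open>After \<open>(m - 1) div 2\<close> firings the loaded copies coincide if
    \<open>m\<close> is odd and are adjacent again if \<open>m\<close> is even.\<close>
  proof (rule exists_positive_rank[where S = S and N = "(m - 1) div 2"])
    fix t v assume t: "t < (m - 1) div 2" and v: "v \<in> pverts ?G"
    then obtain i j where v_eq: "v = (i, j)" and ij: "i < m" "j < n"
      by (auto simp: pverts_stacked_prism)
    define s where "s = m - 2 - t"
    have s: "t < s" "Suc s < m" "m - 1 - Suc t = s" "m - 1 - t = Suc s"
      using t by (auto simp: s_def)
    have "laplacian ?G (\<lambda>v. of_bool (v \<in> S t)) v
        = laplacian ?G (\<lambda>v. of_bool (fst v \<le> t \<or> s < fst v)) v"
      using v by (intro laplacian_cong) (auto simp: pverts_stacked_prism S_def s_def)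
    also have "\<dots> = of_bool (i = t) + of_bool (i = Suc s) - of_bool (i = Suc t) - of_bool (i = s)"
      using laplacian_cycle_arc[OF s(1,2) ij(1)]
      by (simp add: v_eq laplacian_stacked_prism[OF assms(1) ij])
    finally show "h (Suc t) v = h t v - laplacian ?G (\<lambda>v. of_bool (v \<in> S t)) v"
      unfolding h_def s(3,4) by (simp add: v_eq)
  next
    fix v assume "v \<in> pverts ?G"
    then have i: "fst v < m" by (auto simp: pverts_stacked_prism)
    show "\<exists>t\<le>(m - 1) div 2. 0 < h t v"
    proof (cases "fst v \<le> (m - 1) div 2")
      case True
      then show ?thesis by (intro exI[of _ "fst v"]) (simp add: h_def add_pos_nonneg)
    next
      case False
      then show ?thesis using i by (intro exI[of _ "m - 1 - fst v"]) (auto simp: h_def)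
    qed
  qed (use assms in \<open>auto simp: h_def S_def pverts_stacked_prism lessThan_empty_iff\<close>)
  moreover have "(\<Sum>v\<in>pverts ?G. h 0 v) = int (2 * n)"
    using assms
    by (simp add: pverts_stacked_prism h_def of_bool_def sum.distrib sum.cartesian_product'
        flip: sum_distrib_left)
  ultimately show ?thesis by simp
qed

section \<open>Lower bound: cuts and connectedness for the copies of the path\<close>

lemma closed_under_Suc_mod:
  fixes W :: "nat set"
  assumes "i \<in> W" "i < m" and closed: "\<And>a. a < m \<Longrightarrow> a \<in> W \<Longrightarrow> Suc a mod m \<in> W" and "i' < m"
  shows "i' \<in> W"
proof -
  have "(i + d) mod m \<in> W" for d
  proof (induction d)
    case (Suc d)
    then have "Suc ((i + d) mod m) mod m \<in> W" using assms(2) by (intro closed) auto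
    then show ?case by (simp add: mod_Suc_eq)
  qed (use assms in simp)
  \<comment> \<open>This many successor steps lead from \<open>i\<close> to \<open>m + i'\<close>,
    hence to \<open>i'\<close> modulo \<open>m\<close>.\<close>
  from this[of "m - i + i'"] show ?thesis using assms by simp
qed

text \<open>A walk once round any copy of the cycle goes from position \<open>i\<close> in
  \<open>U\<close> to \<open>i'\<close> outside and back, so it leaves \<open>U\<close> along one
  edge and enters it along another.\<close>

lemma stacked_prism_cut:
  assumes m: "m \<ge> 3" and i: "i < m" "i' < m"
    and U: "{i} \<times> {..<n} \<subseteq> U" "({i'} \<times> {..<n}) \<inter> U = {}"
  shows "2 * n \<le> card {(u, v) \<in> parcs (stacked_prism m n). u \<in> U \<and> v \<notin> U}"
proof -
  let ?C = "{(u, v) \<in> parcs (stacked_prism m n). u \<in> U \<and> v \<notin> U}"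
  interpret pair_graph "stacked_prism m n" using m by (rule pair_graph_stacked_prism)
  have "\<exists>a<m. (a, j) \<in> U \<and> (Suc a mod m, j) \<notin> U" if "j < n" for j
    using closed_under_Suc_mod[of i "{a. (a, j) \<in> U}" m i'] that i U by blast
  then obtain a where a: "\<And>j. j < n \<Longrightarrow> a j < m \<and> (a j, j) \<in> U \<and> (Suc (a j) mod m, j) \<notin> U"
    by metis
  have "\<exists>b<m. (b, j) \<notin> U \<and> (Suc b mod m, j) \<in> U" if "j < n" for j
    using closed_under_Suc_mod[of i' "{b. (b, j) \<notin> U}" m i] that i U by blast
  then obtain b where b: "\<And>j. j < n \<Longrightarrow> b j < m \<and> (b j, j) \<notin> U \<and> (Suc (b j) mod m, j) \<in> U"
    by metis
  \<comment> \<open>The flag selects the leaving edge or the entering edge of copy \<open>j\<close>;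
    the latter is reversed so that both arcs point out of \<open>U\<close>.\<close>
  define e where "e p = (case p of (c, j) \<Rightarrow>
      if c then ((a j, j), (Suc (a j) mod m, j)) else ((Suc (b j) mod m, j), (b j, j)))"
    for p :: "bool \<times> nat"
  \<comment> \<open>The leaving and entering edges of a copy could coincide only if two successor
    steps returned to the start, which \<open>m \<ge> 3\<close> excludes.\<close>
  have ne: "Suc (Suc x mod m) mod m \<noteq> x" if "x < m" for x
    using that m by (auto simp: Suc_mod_eq split: if_splits)
  have "inj_on e (UNIV \<times> {..<n})"
    using a b ne by (auto simp: inj_on_def e_def split: if_splits)
  moreover have "e ` (UNIV \<times> {..<n}) \<subseteq> ?C"
    using a b m by (auto simp: e_def parcs_stacked_prism split: if_splits)
  moreover have "finite ?C" by (rule finite_subset[OF _ pair_finite_arcs]) auto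
  ultimately have "card ((UNIV :: bool set) \<times> {..<n}) \<le> card ?C"
    by (rule card_inj_on_le)
  then show ?thesis by (simp add: card_cartesian_product)
qed

text \<open>Otherwise membership in \<open>W\<close> would be constant along the path. This gives
  connectedness of the eggs.\<close>

lemma interval_crossing:
  fixes W :: "nat set"
  assumes "p \<in> W" "q \<notin> W" "p < n" "q < n"
  shows "\<exists>x y. x \<in> W \<and> y \<notin> W \<and> x < n \<and> y < n \<and> (y = Suc x \<or> x = Suc y)"
proof (rule ccontr)
  assume "\<not> ?thesis"
  then have step: "x \<in> W \<longleftrightarrow> Suc x \<in> W" if "Suc x < n" for x
    using that Suc_lessD by blast
  have "x \<in> W \<longleftrightarrow> 0 \<in> W" if "x < n" for x
    using that by (induction x) (use step in auto)
  then show False using assms by blast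
qed

lemma stacked_prism_deg_ge:
  assumes m: "m \<ge> 3" and n: "n \<ge> 1" and rank: "1 \<le> div_rank (stacked_prism m n) D"
  shows "int (min m (2 * n)) \<le> div_deg (stacked_prism m n) D"
proof -
  let ?G = "stacked_prism m n"
  interpret pair_graph ?G using m by (rule pair_graph_stacked_prism)
  let ?\<E> = "(\<lambda>i. {i} \<times> {..<n}) ` {..<m}"
  show ?thesis
  proof (rule scramble_le_deg[where \<E> = ?\<E>, OF _ _ _ _ _ rank])
    show "?\<E> \<noteq> {}" using m by (auto simp: lessThan_empty_iff)
    show "A \<subseteq> pverts ?G \<and> A \<noteq> {}" if "A \<in> ?\<E>" for A
    proof -
      obtain i where "i < m" "A = {i} \<times> {..<n}" using \<open>A \<in> ?\<E>\<close> by blast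
      moreover have "0 \<in> {..<n}" using n by simp
      ultimately show ?thesis by (auto simp: pverts_stacked_prism)
    qed
    show "\<exists>u\<in>A \<inter> W. \<exists>v\<in>A - W. (u, v) \<in> parcs ?G"
      if AW: "A \<in> ?\<E>" "A \<inter> W \<noteq> {}" "A - W \<noteq> {}" for A W
    proof -
      obtain i where A: "A = {i} \<times> {..<n}" "i < m" using AW(1) by blast
      obtain p q where "(i, p) \<in> W" "(i, q) \<notin> W" "p < n" "q < n" using AW A(1) by auto
      then obtain x y where "(i, x) \<in> W" "(i, y) \<notin> W" "x < n" "y < n" "y = Suc x \<or> x = Suc y"
        using interval_crossing[of p "{j. (i, j) \<in> W}" q n] by auto
      then show ?thesis
        using A by (intro bexI[of _ "(i, x)"] bexI[of _ "(i, y)"]) (auto simp: parcs_stacked_prism)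
    qed
    show "\<exists>A\<in>?\<E>. A \<inter> H = {}" if "H \<subseteq> pverts ?G" "card H < min m (2 * n)" for H
    proof (rule ccontr)
      assume "\<not> ?thesis"
      \<comment> \<open>The eggs are the fibres of \<open>fst\<close>, so a set meeting all of them
        projects onto all \<open>m\<close> positions.\<close>
      then have "{..<m} \<subseteq> fst ` H" by (force simp: image_iff)
      moreover have fin: "finite H" using that(1) by (rule finite_subset) simp
      ultimately have "card {..<m} \<le> card H" by (meson card_mono card_image_le finite_imageI le_trans)
      then show False using that(2) by simp
    qed
    show "min m (2 * n) \<le> card {(u, v) \<in> parcs ?G. u \<in> U \<and> v \<notin> U}"
      if "A \<in> ?\<E>" "B \<in> ?\<E>" "A \<subseteq> U" "B \<inter> U = {}" for A B U
      using that stacked_prism_cut[OF m, of _ _ n U] by (auto intro: min.coboundedI2)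
  qed
qed

theorem theorem5p2:
  fixes m n :: nat
  assumes "m \<ge> 3" and "n \<ge> 1" and "m \<noteq> 2 * n"
  shows "gonality (stacked_prism m n) = int (min m (2 * n))"
proof (rule gonality_eqI)
  show "\<exists>D\<in>Div (stacked_prism m n). div_deg (stacked_prism m n) D = int (min m (2 * n)) \<and>
      1 \<le> div_rank (stacked_prism m n) D"
    using stacked_prism_rank_cycle_copy[OF assms(1,2)]
      stacked_prism_rank_path_copies[OF assms(1,2)]
    by (simp add: min_def)
qed (rule stacked_prism_deg_ge[OF assms(1,2)])

end
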